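(* Let $\succcurlyeq$ be a complete binary relation on $\mathbb{R}_+^n$ (not necessarily transitive) such that both $\succcurlyeq$ and its asymmetric part $\succ$ are convex. Then the following are equivalent: $\succcurlyeq$ is Archimedean; $\succcurlyeq$ is mixture-continuous; $\succcurlyeq$ is continuous.
   Context: $x\succ y$ iff $x\succcurlyeq y$ and not $y\succcurlyeq x$. Complete: $x\succcurlyeq y$ or $y\succcurlyeq x$ for all $x,y$. A relation $R$ on $\mathbb{R}_+^n$ is convex if it has convex upper sections, i.e. $\{y\in\mathbb{R}_+^n:y\,R\,x\}$ is convex for all $x\in\mathbb{R}_+^n$. For $\lambda\in[0,1]$, $x\lambda y=\lambda x+(1-\lambda)y$. Archimedean: for all $x,y,z$ with $x\succ y$ there exist $\lambda,\delta\in(0,1)$ with $x\lambda z\succ y$ and $x\succ y\delta z$. Mixture-continuous: for all $x,y,z$, the sets $\{\lambda\in[0,1]:x\lambda y\succcurlyeq z\}$ and $\{\lambda\in[0,1]:z\succcurlyeq x\lambda y\}$ are closed. Continuous: for all $x$, the sets $\{y:y\succcurlyeq x\}$ and $\{y:x\succcurlyeq y\}$ are closed in $\mathbb{R}_+^n$, and the sets $\{y:y\succ x\}$ and $\{y:x\succ y\}$ are open in $\mathbb{R}_+^n$. *)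

theory Defs
  imports "HOL-Analysis.Analysis"
begin

definition orthant :: "(real^'n) set" where
  "orthant = {x. \<forall>i. 0 \<le> x $ i}"

definition mix :: "real^'n \<Rightarrow> real \<Rightarrow> real^'n \<Rightarrow> real^'n" where
  "mix x l y = l *\<^sub>R x + (1 - l) *\<^sub>R y"

text \<open>
  A binary relation on the orthant is a predicate on the whole space of which only the
  restriction to the orthant matters: every notion below ranges over orthant points only.
\<close>

definition asym_part :: "('a \<Rightarrow> 'a \<Rightarrow> bool) \<Rightarrow> 'a \<Rightarrow> 'a \<Rightarrow> bool" where
  "asym_part R x y \<longleftrightarrow> R x y \<and> \<not> R y x"

definition complete_rel :: "(real^'n \<Rightarrow> real^'n \<Rightarrow> bool) \<Rightarrow> bool" where
  "complete_rel R \<longleftrightarrow> (\<forall>x\<in>orthant. \<forall>y\<in>orthant. R x y \<or> R y x)"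

definition convex_rel :: "(real^'n \<Rightarrow> real^'n \<Rightarrow> bool) \<Rightarrow> bool" where
  "convex_rel R \<longleftrightarrow> (\<forall>x\<in>orthant. convex {y\<in>orthant. R y x})"

definition archimedean_rel :: "(real^'n \<Rightarrow> real^'n \<Rightarrow> bool) \<Rightarrow> bool" where
  "archimedean_rel R \<longleftrightarrow>
    (\<forall>x\<in>orthant. \<forall>y\<in>orthant. \<forall>z\<in>orthant. asym_part R x y \<longrightarrow>
      (\<exists>l\<in>{0<..<1}. \<exists>d\<in>{0<..<1}. asym_part R (mix x l z) y \<and> asym_part R x (mix y d z)))"

definition mixture_continuous_rel :: "(real^'n \<Rightarrow> real^'n \<Rightarrow> bool) \<Rightarrow> bool" where
  "mixture_continuous_rel R \<longleftrightarrow>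
    (\<forall>x\<in>orthant. \<forall>y\<in>orthant. \<forall>z\<in>orthant.
      closed {l\<in>{0..1}. R (mix x l y) z} \<and> closed {l\<in>{0..1}. R z (mix x l y)})"

definition continuous_rel :: "(real^'n \<Rightarrow> real^'n \<Rightarrow> bool) \<Rightarrow> bool" where
  "continuous_rel R \<longleftrightarrow>
    (\<forall>x\<in>orthant.
      closedin (top_of_set orthant) {y\<in>orthant. R y x} \<and>
      closedin (top_of_set orthant) {y\<in>orthant. R x y} \<and>
      openin (top_of_set orthant) {y\<in>orthant. asym_part R y x} \<and>
      openin (top_of_set orthant) {y\<in>orthant. asym_part R x y})"

end

theory Submission
  imports Defs
begin

text \<open>
  Fix \<open>x\<close>. The Archimedean property and convexity make the strict upper section and the strict lower
  section of \<open>x\<close> radially open: from each of their points one can move a little towards any other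
  point of the orthant. The strict upper section is moreover convex. As the orthant near a point is
  the convex hull of segments parallel to the axes, radial openness along the axes already makes a
  convex set open. The strict lower section is instead the complement of a convex set \<open>W\<close>. If it
  contained a limit point \<open>y\<close> of \<open>W\<close>, then the segment from \<open>y\<close> to a relative interior point of \<open>W\<close>
  would lie in \<open>W\<close> except for \<open>y\<close>, against radial openness at \<open>y\<close>. The remaining implications
  only restrict sections to segments.
\<close>

text \<open>The weight \<open>t\<close> is put on \<open>z\<close>, so that \<open>t = 0\<close>
  gives \<open>u\<close>. A whole initial piece of the segment is demanded, whereas the Archimedean
  property supplies a single point of it.\<close>

definition radially_open :: "(real^'n) set \<Rightarrow> bool" where
  "radially_open S \<longleftrightarrow> (\<forall>u\<in>S. \<forall>z\<in>orthant. \<exists>e>0. \<forall>t\<in>{0..e}. mix z t u \<in> S)"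

lemma mix_in_convex:
  assumes "convex S" "x \<in> S" "y \<in> S" "0 \<le> l" "l \<le> 1"
  shows "mix x l y \<in> S"
  using convexD[OF assms(1-3), of l "1 - l"] assms(4,5) by (simp add: mix_def)

lemma convex_orthant: "convex (orthant :: (real^'n) set)"
  unfolding convex_def orthant_def by auto

lemmas mix_in_orthant = mix_in_convex[OF convex_orthant]

lemma mix_mix_right: "mix (mix z t u) s u = mix z (s * t) u"
  by (simp add: mix_def algebra_simps)

lemma mix_flip: "mix x l y = mix y (1 - l) x"
  by (simp add: mix_def)

lemma continuous_on_mix: "continuous_on A (\<lambda>l. mix x l y)"
  unfolding mix_def by (intro continuous_intros)

text \<open>Convexity fills in the segment between \<open>u\<close> and the one point of
  \<open>S\<close> supplied towards \<open>z\<close>.\<close>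

lemma radially_open_of_convex:
  fixes S :: "(real^'n) set"
  assumes "convex S"
    and "\<And>u z. u \<in> S \<Longrightarrow> z \<in> orthant \<Longrightarrow> \<exists>l\<in>{0<..<1}. mix u l z \<in> S"
  shows "radially_open S"
  unfolding radially_open_def
proof (intro ballI)
  fix u z :: "real^'n"
  assume u: "u \<in> S" and "z \<in> orthant"
  then obtain l where l: "l \<in> {0<..<1}" "mix z (1 - l) u \<in> S"
    using assms(2) by (metis mix_flip)
  have "mix z t u \<in> S" if "t \<in> {0..1 - l}" for t
    using mix_in_convex[OF assms(1) l(2) u, of "t / (1 - l)"] that l(1)
    by (simp add: mix_mix_right divide_le_eq)
  then show "\<exists>e>0. \<forall>t\<in>{0..e}. mix z t u \<in> S"
    using l(1) by (intro exI[of _ "1 - l"]) auto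
qed

text \<open>\<open>W\<close> meets the segment from \<open>u\<close> to \<open>z\<close> in an
  interval. If that is nonempty, \<open>arch\<close> is aimed at one of its points instead of at
  \<open>z\<close>: the point outside \<open>W\<close> found this way precedes the interval, while
  one found towards \<open>z\<close> could lie beyond it.\<close>

lemma radially_open_of_convex_complement:
  fixes W :: "(real^'n) set"
  assumes "convex W" "W \<subseteq> orthant"
    and arch: "\<And>u z. u \<in> orthant - W \<Longrightarrow> z \<in> orthant \<Longrightarrow> \<exists>l\<in>{0<..<1}. mix u l z \<in> orthant - W"
  shows "radially_open (orthant - W)"
  unfolding radially_open_def
proof (intro ballI)
  fix u z :: "real^'n"
  assume u: "u \<in> orthant - W" and z: "z \<in> orthant"
  have orth: "mix z t u \<in> orthant" if "0 \<le> t" "t \<le> 1" for t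
    using mix_in_orthant z u that by blast
  show "\<exists>e>0. \<forall>t\<in>{0..e}. mix z t u \<in> orthant - W"
  proof (cases "\<exists>r\<in>{0<..1}. mix z r u \<in> W")
    case True
    then obtain r where r: "0 < r" "r \<le> 1" "mix z r u \<in> W" by auto
    obtain l where l: "l \<in> {0<..<1}" "mix (mix z r u) (1 - l) u \<in> orthant - W"
      using arch[OF u orth[of r]] r unfolding mix_flip[of u] by auto
    define e where "e = (1 - l) * r"
    have e: "0 < e" "e < r" "mix z e u \<notin> W"
      using l r by (auto simp: e_def mix_mix_right)
    \<comment> \<open>Convexity of W: a point of W before e would, with the one at r, put e into W.\<close>
    have "mix z t u \<notin> W" if t: "t \<in> {0..e}" for t
    proof
      assume "mix z t u \<in> W"
      moreover define s where "s = (e - t) / (r - t)"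
      moreover have "0 \<le> s" "s \<le> 1" using t e by (auto simp: s_def)
      ultimately have "mix (mix z r u) s (mix z t u) \<in> W"
        using mix_in_convex[OF assms(1) r(3)] by blast
      moreover have "mix (mix z r u) s (mix z t u) = mix z (t + s * (r - t)) u"
        by (simp add: mix_def algebra_simps)
      moreover have "t + s * (r - t) = e" using t e by (simp add: s_def)
      ultimately have "mix z e u \<in> W" by simp
      with e show False by simp
    qed
    then show ?thesis using e r orth by (intro exI[of _ e]) auto
  next
    case False
    have "mix z t u \<in> orthant - W" if "t \<in> {0..1}" for t
      using False u orth that by (cases "t = 0") (auto simp: mix_def)
    then show ?thesis by (intro exI[of _ 1]) auto
  qed
qed

lemma radially_open_axis:
  fixes S :: "(real^'n) set"
  assumes S: "radially_open S" "S \<subseteq> orthant" and u: "u \<in> S" and "c > 0"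
  shows "\<exists>d>0. \<forall>y\<in>orthant. \<bar>y $ i - u $ i\<bar> < d \<longrightarrow> u + (c * (y $ i - u $ i)) *\<^sub>R axis i 1 \<in> S"
proof -
  \<comment> \<open>Radial openness only speaks of directions towards points of the orthant.
    Downwards along axis \<open>i\<close>, the farthest such point is \<open>u\<close> with
    coordinate \<open>i\<close> set to 0.\<close>
  let ?up = "u + axis i 1" and ?down = "u - (u $ i) *\<^sub>R axis i 1"
  have u0: "0 \<le> u $ j" for j using S u by (auto simp: orthant_def)
  have "?up \<in> orthant" "?down \<in> orthant"
    using u0 by (auto simp: orthant_def axis_def)
  then obtain e f where e: "e > 0" "\<And>t. 0 \<le> t \<Longrightarrow> t \<le> e \<Longrightarrow> mix ?up t u \<in> S"
    and f: "f > 0" "\<And>t. 0 \<le> t \<Longrightarrow> t \<le> f \<Longrightarrow> mix ?down t u \<in> S"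
    using S(1) u unfolding radially_open_def by (metis atLeastAtMost_iff)
  have up: "mix ?up t u = u + t *\<^sub>R axis i 1" for t
    by (simp add: mix_def algebra_simps)
  have down: "mix ?down t u = u - (t * u $ i) *\<^sub>R axis i 1" for t
    by (simp add: mix_def algebra_simps)
  \<comment> \<open>If \<open>u $ i = 0\<close>, no \<open>y\<close> in the orthant lies below
    \<open>u\<close> in coordinate \<open>i\<close>, so the downward bound is vacuous and 1 is an
    arbitrary positive value.\<close>
  define d where "d = min (e / c) (if u $ i = 0 then 1 else f * u $ i / c)"
  have d: "d > 0" using e f \<open>c > 0\<close> u0[of i] by (auto simp: d_def)
  moreover have "u + (c * (y $ i - u $ i)) *\<^sub>R axis i 1 \<in> S"
    if y: "y \<in> orthant" and less: "\<bar>y $ i - u $ i\<bar> < d" for y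
  proof (cases "y $ i \<ge> u $ i")
    case True
    have "\<bar>y $ i - u $ i\<bar> < e / c" using less by (simp add: d_def)
    then have "c * (y $ i - u $ i) \<le> e"
      using True \<open>c > 0\<close> by (simp add: less_divide_eq mult.commute)
    then show ?thesis using e(2)[of "c * (y $ i - u $ i)"] True \<open>c > 0\<close> by (simp add: up)
  next
    case False
    have "0 \<le> y $ i" using y by (simp add: orthant_def)
    with False have pos: "0 < u $ i" by simp
    define t where "t = c * (u $ i - y $ i) / u $ i"
    have "\<bar>y $ i - u $ i\<bar> < f * u $ i / c" using less pos by (simp add: d_def)
    then have "c * (u $ i - y $ i) \<le> f * u $ i"
      using False \<open>c > 0\<close> by (simp add: less_divide_eq mult.commute)
    then have "0 \<le> t" "t \<le> f" using False \<open>c > 0\<close> pos by (auto simp: t_def divide_le_eq)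
    moreover have "t * u $ i = - (c * (y $ i - u $ i))" using pos by (simp add: t_def right_diff_distrib)
    ultimately show ?thesis using f(2)[of t] unfolding down by simp
  qed
  ultimately show ?thesis by blast
qed

lemma openin_of_convex_radially_open:
  fixes S :: "(real^'n) set"
  assumes "convex S" "radially_open S" "S \<subseteq> orthant"
  shows "openin (top_of_set orthant) S"
  unfolding openin_euclidean_subtopology_iff
proof (intro conjI ballI)
  fix u assume u: "u \<in> S"
  let ?n = "real CARD('n)"
  have n: "?n > 0" by simp
  obtain d where d: "\<And>i. d i > 0" and dS: "\<And>i y. y \<in> orthant \<Longrightarrow> \<bar>y $ i - u $ i\<bar> < d i
      \<Longrightarrow> u + (?n * (y $ i - u $ i)) *\<^sub>R axis i 1 \<in> S"
    using radially_open_axis[OF assms(2,3) u n] by metis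
  have "y \<in> S" if y: "y \<in> orthant" and less: "dist y u < Min (range d)" for y
  proof -
    have "\<bar>y $ i - u $ i\<bar> < d i" for i
      using component_le_norm_cart[of "y - u" i] less by (auto simp: dist_norm intro: le_less_trans)
    \<comment> \<open>y is the average of its one-coordinate changes of u, each magnified by the dimension.\<close>
    then have "(\<Sum>i\<in>UNIV. (1 / ?n) *\<^sub>R (u + (?n * (y $ i - u $ i)) *\<^sub>R axis i 1)) \<in> S"
      using dS[OF y] by (intro convex_sum assms(1)) auto
    moreover have "(\<Sum>i\<in>UNIV. (1 / ?n) *\<^sub>R (u + (?n * (y $ i - u $ i)) *\<^sub>R axis i 1)) = y"
      using basis_expansion[of "y - u"]
      by (simp add: scaleR_right_distrib sum.distrib scalar_mult_eq_scaleR sum_constant_scaleR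
          del: sum_constant flip: scaleR_left.sum)
    ultimately show ?thesis by simp
  qed
  moreover have "Min (range d) > 0" using d by simp
  ultimately show "\<exists>e>0. \<forall>y\<in>orthant. dist y u < e \<longrightarrow> y \<in> S" by blast
qed (use assms in auto)

lemma closedin_of_convex_radially_open_complement:
  fixes W :: "(real^'n) set"
  assumes "convex W" "W \<subseteq> orthant" "radially_open (orthant - W)"
  shows "closedin (top_of_set orthant) W"
proof -
  have "y \<in> W" if y: "y \<in> orthant" "y \<in> closure W" for y
  proof (rule ccontr)
    assume "y \<notin> W"
    \<comment> \<open>A nonempty convex set may have empty interior, but never empty relative
      interior.\<close>
    obtain w where w: "w \<in> rel_interior W"
      using y rel_interior_eq_empty[OF assms(1)] by (cases "W = {}") auto
    then have "w \<in> orthant" using rel_interior_subset assms(2) by blast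
    then obtain e where e: "e > 0" "\<And>t. 0 \<le> t \<Longrightarrow> t \<le> e \<Longrightarrow> mix w t y \<notin> W"
      using assms(3) y \<open>y \<notin> W\<close> unfolding radially_open_def
      by (metis DiffD2 DiffI atLeastAtMost_iff)
    \<comment> \<open>The cap at 1 keeps the shrunk point on the segment from \<open>y\<close> to
      \<open>w\<close>.\<close>
    define t where "t = min e 1"
    have "y - t *\<^sub>R (y - w) \<in> rel_interior W"
      using rel_interior_closure_convex_shrink[OF assms(1) w y(2), of t] e by (simp add: t_def)
    moreover have "y - t *\<^sub>R (y - w) = mix w t y" by (simp add: mix_def algebra_simps)
    ultimately have "mix w t y \<in> W" using rel_interior_subset by fastforce
    moreover have "mix w t y \<notin> W" using e by (simp add: t_def)
    ultimately show False by contradiction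
  qed
  then have "W = orthant \<inter> closure W" using assms(2) closure_subset by blast
  then show ?thesis by (metis closed_closure closedin_closed_Int)
qed

text \<open>Convexity is assumed of upper sections only; through these complements it also bears on
  the lower ones.\<close>

lemma complete_rel_complements:
  assumes "complete_rel R" "x \<in> orthant"
  shows "{y\<in>orthant. asym_part R x y} = orthant - {y\<in>orthant. R y x}"
    and "{y\<in>orthant. R x y} = orthant - {y\<in>orthant. asym_part R y x}"
  using assms unfolding complete_rel_def asym_part_def by blast+

lemma archimedean_imp_continuous:
  fixes R :: "real^'n \<Rightarrow> real^'n \<Rightarrow> bool"
  assumes "complete_rel R" "convex_rel R" "convex_rel (asym_part R)" "archimedean_rel R"
  shows "continuous_rel R"
  unfolding continuous_rel_def
proof
  fix x :: "real^'n" assume x: "x \<in> orthant"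
  note complements = complete_rel_complements[OF assms(1) x]
  let ?U = "{y\<in>orthant. asym_part R y x}" and ?W = "{y\<in>orthant. R y x}"
  have cU: "convex ?U" and cW: "convex ?W"
    using assms x unfolding convex_rel_def by blast+
  have "\<exists>l\<in>{0<..<1}. mix u l z \<in> ?U" if uz: "u \<in> ?U" "z \<in> orthant" for u z
  proof -
    obtain l where "l \<in> {0<..<1}" "asym_part R (mix u l z) x"
      using assms(4) uz x unfolding archimedean_rel_def by blast
    then show ?thesis using mix_in_orthant[of u z l] uz by force
  qed
  then have U: "openin (top_of_set orthant) ?U"
    using cU by (intro openin_of_convex_radially_open radially_open_of_convex) auto
  \<comment> \<open>Here the second half of the Archimedean property is used, where the worse point
    is mixed; for \<open>?U\<close> it was the first.\<close>
  have "\<exists>l\<in>{0<..<1}. mix u l z \<in> orthant - ?W" if uz: "u \<in> orthant - ?W" "z \<in> orthant" for u z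
  proof -
    obtain l where "l \<in> {0<..<1}" "asym_part R x (mix u l z)"
      using assms(4) uz x unfolding archimedean_rel_def complements(1)[symmetric] by blast
    then show ?thesis
      using mix_in_orthant[of u z l] uz unfolding complements(1)[symmetric] by force
  qed
  then have W: "closedin (top_of_set orthant) ?W"
    using cW
    by (intro closedin_of_convex_radially_open_complement radially_open_of_convex_complement) auto
  show "closedin (top_of_set orthant) ?W \<and>
      closedin (top_of_set orthant) {y\<in>orthant. R x y} \<and>
      openin (top_of_set orthant) ?U \<and>
      openin (top_of_set orthant) {y\<in>orthant. asym_part R x y}"
    using U W closedin_diff[OF closedin_topspace U] openin_diff[OF openin_topspace W]
    unfolding complements by simp
qed

lemma continuous_imp_mixture_continuous:
  fixes R :: "real^'n \<Rightarrow> real^'n \<Rightarrow> bool"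
  assumes "continuous_rel R"
  shows "mixture_continuous_rel R"
  unfolding mixture_continuous_rel_def
proof (intro ballI)
  fix x y z :: "real^'n"
  assume x: "x \<in> orthant" and y: "y \<in> orthant" and z: "z \<in> orthant"
  have closed: "closed {l\<in>{0..1}. P (mix x l y)}"
    if "closedin (top_of_set orthant) {v\<in>orthant. P v}" for P
  proof -
    \<comment> \<open>The weights form the preimage of the section under the parametrisation of the
      segment, a continuous map from the unit interval into the orthant.\<close>
    have "closedin (top_of_set {0..1}) ({0..1} \<inter> (\<lambda>l. mix x l y) -` {v\<in>orthant. P v})"
      using that mix_in_orthant[OF x y]
      by (intro continuous_closedin_preimage_gen[OF continuous_on_mix]) auto
    moreover have "{0..1} \<inter> (\<lambda>l. mix x l y) -` {v\<in>orthant. P v} = {l\<in>{0..1}. P (mix x l y)}"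
      using mix_in_orthant[OF x y] by auto
    ultimately show ?thesis by (metis closed_atLeastAtMost closedin_closed_trans)
  qed
  show "closed {l\<in>{0..1}. R (mix x l y) z} \<and> closed {l\<in>{0..1}. R z (mix x l y)}"
    using assms z unfolding continuous_rel_def by (intro conjI closed) auto
qed

lemma ex_less_one_notin_closed:
  fixes C :: "real set"
  assumes "closed C" "1 \<notin> C"
  shows "\<exists>l\<in>{0<..<1}. l \<notin> C"
proof -
  obtain e where e: "e > 0" "ball 1 e \<subseteq> - C"
    using assms by (metis ComplI open_Compl open_contains_ball)
  define l where "l = 1 - min e 1 / 2"
  have "l \<in> {0<..<1}" "l \<in> ball 1 e" using e by (auto simp: l_def dist_real_def)
  then show ?thesis using e by blast
qed

text \<open>By completeness, strict preference is failure of the reverse weak preference. The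
  weights at which the reverse holds form a closed set. It misses 1, where the mixture is its first
  point, and hence also some weight below 1.\<close>

lemma mixture_continuous_imp_archimedean:
  fixes R :: "real^'n \<Rightarrow> real^'n \<Rightarrow> bool"
  assumes complete: "complete_rel R" and "mixture_continuous_rel R"
  shows "archimedean_rel R"
  unfolding archimedean_rel_def
proof (intro ballI impI)
  fix x y z :: "real^'n"
  assume x: "x \<in> orthant" and y: "y \<in> orthant" and z: "z \<in> orthant" and xy: "asym_part R x y"
  have strict: "asym_part R a b" if "a \<in> orthant" "b \<in> orthant" "\<not> R b a" for a b
    using complete that unfolding complete_rel_def asym_part_def by blast
  have C: "closed {l\<in>{0..1}. R y (mix x l z)}" "closed {l\<in>{0..1}. R (mix y l z) x}"
    using assms(2) x y z unfolding mixture_continuous_rel_def by blast+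
  obtain l where l: "l \<in> {0<..<1}" "\<not> R y (mix x l z)"
    using ex_less_one_notin_closed[OF C(1)] xy by (auto simp: mix_def asym_part_def)
  obtain d where d: "d \<in> {0<..<1}" "\<not> R (mix y d z) x"
    using ex_less_one_notin_closed[OF C(2)] xy by (auto simp: mix_def asym_part_def)
  have "mix x l z \<in> orthant" "mix y d z \<in> orthant"
    using mix_in_orthant[OF x z] mix_in_orthant[OF y z] l d by auto
  then show "\<exists>l\<in>{0<..<1}. \<exists>d\<in>{0<..<1}. asym_part R (mix x l z) y \<and> asym_part R x (mix y d z)"
    using strict x y l d by blast
qed

theorem proposition7:
  fixes R :: "real^'n \<Rightarrow> real^'n \<Rightarrow> bool"
  assumes "complete_rel R"
    and "convex_rel R"
    and "convex_rel (asym_part R)"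
  shows "(archimedean_rel R \<longleftrightarrow> mixture_continuous_rel R) \<and>
         (mixture_continuous_rel R \<longleftrightarrow> continuous_rel R)"
  using archimedean_imp_continuous[OF assms] continuous_imp_mixture_continuous
    mixture_continuous_imp_archimedean[OF assms(1)] by blast

end
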